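(* Let $(X,d,\mu)$ be a metric measure space, and let $\mu$ be weakly $(1+\sqrt{2})$-bling with constant $C$. Then the uncentered Hardy-Littlewood maximal operator $M^u_\mu$ associated with $\mu$ satisfies $\|M^u_\mu\|_{L^1\to L^{1,\infty}}\le C^2$.
   Context: Balls in a metric space $(X,d)$ are sets of points, of the form $B^{\mathrm{o}}(x,r)=\{y\in X: d(x,y)<r\}$ (open balls) or $B^{\mathrm{cl}}(x,r)=\{y\in X: d(x,y)\le r\}$ (closed balls), with $r>0$. $B(x,r)$ denotes a ball without specifying which kind, but all balls under consideration are of the same kind (all open or all closed). Centers and radii of a ball need not be unique. A Borel measure $\mu$ on $X$ is $\tau$-additive if for every collection $\{O_\alpha:\alpha\in\Lambda\}$ of open sets, $\mu(\bigcup_\alpha O_\alpha)=\sup_{\mathcal{F}}\mu(\bigcup_{i=1}^n O_{\alpha_i})$, where the supremum is taken over all finite subcollections $\mathcal{F}=\{O_{\alpha_1},\dots,O_{\alpha_n}\}$ of $\{O_\alpha:\alpha\in\Lambda\}$. It is locally finite if it assigns finite measure to bounded Borel sets. $(X,d,\mu)$ is a metric measure space if $\mu$ is a $\tau$-additive, locally finite Borel measure on the metric space $(X,d)$. Measures are always assumed not identically zero. For $t>1$ and $C\ge 1$, a Borel measure $\mu$ on $(X,d)$ is weakly $t$-bling with constant $C$ (has weakly bounded $t$-growth) if for every ball $B$ of $X$ it is possible to find an $x\in B$ and an $r>0$ with $B=B(x,r)$ and $\mu(B(x,tr))\le C\mu(B(x,r))$. For a locally integrable function $g$ on $X$, the uncentered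 Hardy-Littlewood maximal operator is $$M^u_\mu g(x):=\sup_{\{B\,:\,0<\mu(B)\text{ and }x\in B\}}\frac{1}{\mu(B)}\int_B|g|\,d\mu,$$ the supremum being over balls $B$. $\|M^u_\mu\|_{L^1\to L^{1,\infty}}$ denotes the lowest constant $c$ such that $\mu(\{M^u_\mu g>\alpha\})\le \frac{c\,\|g\|_{L^1(\mu)}}{\alpha}$ for all $g\in L^1(\mu)$ and all $\alpha>0$. *)

theory Defs
  imports "HOL-Analysis.Analysis"
begin

datatype ball_kind = Open | Closed

fun kball :: "ball_kind \<Rightarrow> 'a::metric_space \<Rightarrow> real \<Rightarrow> 'a set" where
  "kball Open x r = ball x r"
| "kball Closed x r = cball x r"

text \<open>Balls are sets of points: a member of this collection may have several centers and radii.\<close>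

definition balls :: "ball_kind \<Rightarrow> 'a::metric_space set set" where
  "balls k = {B. \<exists>x r. r > 0 \<and> B = kball k x r}"

definition tau_additive :: "'a::topological_space measure \<Rightarrow> bool" where
  "tau_additive M \<longleftrightarrow>
    (\<forall>\<U>. (\<forall>U\<in>\<U>. open U) \<longrightarrow>
      emeasure M (\<Union>\<U>) = (SUP \<F>\<in>{\<F>. finite \<F> \<and> \<F> \<subseteq> \<U>}. emeasure M (\<Union>\<F>)))"

definition locally_finite_measure :: "'a::metric_space measure \<Rightarrow> bool" where
  "locally_finite_measure M \<longleftrightarrow> (\<forall>A\<in>sets borel. bounded A \<longrightarrow> emeasure M A < \<infinity>)"

definition metric_measure_space :: "'a::metric_space measure \<Rightarrow> bool" where
  "metric_measure_space M \<longleftrightarrow>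
    sets M = sets borel \<and> tau_additive M \<and> locally_finite_measure M \<and> emeasure M UNIV \<noteq> 0"

definition weakly_bling ::
    "ball_kind \<Rightarrow> real \<Rightarrow> real \<Rightarrow> 'a::metric_space measure \<Rightarrow> bool" where
  "weakly_bling k t C M \<longleftrightarrow>
    (\<forall>B\<in>balls k. \<exists>x\<in>B. \<exists>r>0. B = kball k x r \<and>
      emeasure M (kball k x (t * r)) \<le> ennreal C * emeasure M (kball k x r))"

definition uncentered_maximal ::
    "ball_kind \<Rightarrow> 'a::metric_space measure \<Rightarrow> ('a \<Rightarrow> real) \<Rightarrow> 'a \<Rightarrow> ennreal" where
  "uncentered_maximal k M g x =
    (SUP B\<in>{B \<in> balls k. 0 < emeasure M B \<and> x \<in> B}.
      (\<integral>\<^sup>+y\<in>B. ennreal \<bar>g y\<bar> \<partial>M) / emeasure M B)"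

text \<open>The infimum is taken in the extended nonnegative reals, so it is infinite if no finite
  constant works.\<close>

definition weak_type_norm ::
    "'a measure \<Rightarrow> (('a \<Rightarrow> real) \<Rightarrow> 'a \<Rightarrow> ennreal) \<Rightarrow> ennreal" where
  "weak_type_norm M T =
    Inf {c. \<forall>g \<alpha>. integrable M g \<longrightarrow> \<alpha> > 0 \<longrightarrow>
      emeasure M {x \<in> space M. T g x > ennreal \<alpha>}
        \<le> c * (\<integral>\<^sup>+y. ennreal \<bar>g y\<bar> \<partial>M) / ennreal \<alpha>}"

text \<open>The superlevel sets of the maximal function are open for both kinds of balls, hence
  measurable, so that the default value of \<^const>\<open>emeasure\<close> on nonmeasurable sets plays
  no role in \<^const>\<open>weak_type_norm\<close>.\<close>

lemma open_uncentered_maximal_superlevel: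
  fixes M :: "'a::metric_space measure"
  assumes M: "metric_measure_space M"
  shows "open {x. uncentered_maximal k M g x > ennreal \<alpha>}"
proof (rule iffD2[OF open_subopen], rule ballI)
  fix x assume "x \<in> {x. uncentered_maximal k M g x > ennreal \<alpha>}"
  then obtain y r where yr: "r > 0" "x \<in> kball k y r" "0 < emeasure M (kball k y r)"
    and gt: "ennreal \<alpha> < (\<integral>\<^sup>+z\<in>kball k y r. ennreal \<bar>g z\<bar> \<partial>M) / emeasure M (kball k y r)"
    unfolding uncentered_maximal_def balls_def by (auto simp: less_SUP_iff)
  have sup: "ennreal \<alpha> < uncentered_maximal k M g z"
    if "s > 0" "z \<in> kball k y s" "0 < emeasure M (kball k y s)"
      "ennreal \<alpha> < (\<integral>\<^sup>+z\<in>kball k y s. ennreal \<bar>g z\<bar> \<partial>M) / emeasure M (kball k y s)" for z s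
    unfolding uncentered_maximal_def less_SUP_iff using that by (auto simp: balls_def)
  show "\<exists>T. open T \<and> x \<in> T \<and> T \<subseteq> {x. uncentered_maximal k M g x > ennreal \<alpha>}"
  proof (cases k)
    case Open
    have "kball k y r = ball y r" by (auto simp: Open)
    then show ?thesis using sup[OF yr(1) _ yr(3) gt] yr(2) by (intro exI[of _ "ball y r"]) auto
  next
    case Closed
    have kb: "kball k y s = cball y s" for s by (auto simp: Closed)
    define D where "D n = cball y (r + 1 / real (Suc n))" for n
    have sM: "sets M = sets borel" using M by (simp add: metric_measure_space_def)
    have fin: "emeasure M (cball y s) < \<infinity>" for s
      using M unfolding metric_measure_space_def locally_finite_measure_def by auto
    have dec: "decseq D"
      unfolding D_def decseq_def by (auto intro!: subset_cball divide_left_mono)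
    have int: "(\<Inter>n. D n) = cball y r"
    proof (intro equalityI subsetI)
      fix z assume "z \<in> (\<Inter>n. D n)"
      then have "dist y z \<le> r + 1 / real (Suc n)" for n by (auto simp: D_def)
      moreover have "(\<lambda>n. r + 1 / real (Suc n)) \<longlonglongrightarrow> r + 0"
        by (intro tendsto_intros LIMSEQ_Suc[OF lim_1_over_n])
      ultimately have "dist y z \<le> r + 0" by (intro LIMSEQ_le_const) auto
      then show "z \<in> cball y r" by simp
    next
      fix z assume "z \<in> cball y r"
      moreover have "0 \<le> 1 / real (Suc n)" for n by simp
      ultimately show "z \<in> (\<Inter>n. D n)" by (auto simp: D_def intro: order_trans add_increasing2)
    qed
    let ?I = "\<integral>\<^sup>+z\<in>cball y r. ennreal \<bar>g z\<bar> \<partial>M"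
    have lim: "(\<lambda>n. emeasure M (D n)) \<longlonglongrightarrow> emeasure M (cball y r)"
      unfolding int[symmetric]
      using fin by (intro Lim_emeasure_decseq dec) (auto simp: sM D_def less_top)
    have pos: "0 < emeasure M (cball y r)" using yr kb by simp
    have "ennreal \<alpha> * emeasure M (cball y r) < ?I"
    proof (rule ccontr)
      assume "\<not> ?thesis"
      then have "?I / emeasure M (cball y r) \<le> ennreal \<alpha>"
        using pos by (intro divide_le_posI_ennreal) (auto simp: mult.commute)
      then show False using gt unfolding kb by simp
    qed
    moreover have "(\<lambda>n. ennreal \<alpha> * emeasure M (D n)) \<longlonglongrightarrow> ennreal \<alpha> * emeasure M (cball y r)"
      by (intro ennreal_tendsto_cmult lim) auto
    ultimately have "\<forall>\<^sub>F n in sequentially. ennreal \<alpha> * emeasure M (D n) < ?I"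
      by (rule order_tendstoD(2)[rotated])
    then obtain n where n: "ennreal \<alpha> * emeasure M (D n) < ?I"
      by (auto simp: eventually_sequentially)
    define s where "s = r + 1 / real (Suc n)"
    have s: "r < s" "D n = cball y s" by (auto simp: s_def D_def)
    have sub: "cball y r \<subseteq> cball y s" using s(1) by (simp add: subset_cball)
    have spos: "0 < emeasure M (cball y s)"
      using pos emeasure_mono[OF sub, of M] by (simp add: sM)
    have "?I \<le> (\<integral>\<^sup>+z\<in>cball y s. ennreal \<bar>g z\<bar> \<partial>M)"
      using sub by (intro nn_integral_mono) (auto simp: indicator_def)
    with n s have lt: "ennreal \<alpha> * emeasure M (cball y s) < (\<integral>\<^sup>+z\<in>cball y s. ennreal \<bar>g z\<bar> \<partial>M)"
      by simp
    have "ennreal \<alpha> < (\<integral>\<^sup>+z\<in>cball y s. ennreal \<bar>g z\<bar> \<partial>M) / emeasure M (cball y s)"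
    proof (rule ccontr)
      let ?J = "\<integral>\<^sup>+z\<in>cball y s. ennreal \<bar>g z\<bar> \<partial>M"
      assume "\<not> ?thesis"
      then have "?J / emeasure M (cball y s) * emeasure M (cball y s)
          \<le> ennreal \<alpha> * emeasure M (cball y s)"
        by (intro mult_right_mono) auto
      moreover have "?J / emeasure M (cball y s) * emeasure M (cball y s) = ?J"
        using spos fin[of s] by (simp add: ennreal_divide_times)
      ultimately show False using lt by simp
    qed
    then have "cball y s \<subseteq> {x. uncentered_maximal k M g x > ennreal \<alpha>}"
      using sup[of s] spos s(1) yr(1) unfolding kb by (simp add: subset_iff)
    then have "ball y s \<subseteq> {x. uncentered_maximal k M g x > ennreal \<alpha>}"
      using ball_subset_cball by blast
    moreover have "x \<in> ball y s" using yr(2) s(1) unfolding kb by simp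
    ultimately show ?thesis by (intro exI[of _ "ball y s"]) simp
  qed
qed

end

theory Submission
  imports Defs
begin

text \<open>
  Write \<open>t = 1 + \<surd>2\<close>. Given a ball \<open>B(x, r)\<close> with \<open>\<mu>(B(x, t r)) \<le> C \<mu>(B(x, r))\<close>, apply the
  bounded growth condition a second time, to the ball \<open>B(x, t r)\<close>: it equals \<open>B(x', r')\<close> for some
  \<open>x'\<close>, \<open>r'\<close> with \<open>\<mu>(B(x', t r')) \<le> C\<^sup>2 \<mu>(B(x, r))\<close>. Every ball \<open>B(y, s)\<close> with \<open>s \<le> r\<close> that meets
  \<open>B(x, r)\<close> lies in \<open>B(x', t r')\<close>. Indeed \<open>y \<in> B(x, 2 r) \<subseteq> B(x', r')\<close>, which settles the case
  \<open>s \<le> \<surd>2 r'\<close>; otherwise \<open>d(x, y) \<le> 2 r' < \<surd>2 s \<le> \<surd>2 r\<close>, and \<open>B(y, s) \<subseteq> B(x, t r)\<close>. So \<open>B(x', t r')\<close>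
  takes the role of the threefold dilation in the Vitali covering argument.
\<close>

section \<open>Inclusions between balls and the engulfing set\<close>

lemma kball_subset_kball:
  fixes x y :: "'a::metric_space"
  assumes "dist x y + r \<le> R"
  shows "kball k y r \<subseteq> kball k x R"
proof
  fix z assume "z \<in> kball k y r"
  then show "z \<in> kball k x R"
    using assms dist_triangle[of x z y] by (cases k) auto
qed

lemma dist_le_of_mem_kball: "z \<in> kball k x r \<Longrightarrow> dist x z \<le> r"
  by (cases k) auto

lemma center_mem_kball: "r > 0 \<Longrightarrow> x \<in> kball k x r"
  by (cases k) auto

lemma center_mem_kball_of_meets:
  assumes "kball k x r \<inter> kball k y s \<noteq> {}" and "r + s \<le> R"
  shows "y \<in> kball k x R"
proof -
  obtain z where "z \<in> kball k x r" "z \<in> kball k y s"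
    using assms(1) by blast
  then show ?thesis
    using assms(2) dist_triangle[of x y z] by (cases k) (auto simp: dist_commute)
qed

lemma kball_in_balls: "r > 0 \<Longrightarrow> kball k x r \<in> balls k"
  by (auto simp: balls_def)

lemma kball_borel [measurable]: "kball k x r \<in> sets borel"
  by (cases k) auto

lemma kball_subset_of_meets:
  fixes x y x' :: "'a::metric_space"
  assumes r: "r > 0" and sr: "s \<le> r"
    and meets: "kball k x r \<inter> kball k y s \<noteq> {}"
    and eq: "kball k x ((1 + sqrt 2) * r) = kball k x' r'" and r': "r' > 0"
  shows "kball k y s \<subseteq> kball k x' ((1 + sqrt 2) * r')"
proof -
  have sqrt2: "1 \<le> sqrt 2" by simp
  have "r * 1 \<le> r * sqrt 2" using r sqrt2 by (intro mult_left_mono) auto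
  then have "r + s \<le> (1 + sqrt 2) * r" using sr by (simp add: algebra_simps)
  from center_mem_kball_of_meets[OF meets this] have "y \<in> kball k x' r'"
    unfolding eq .
  then have dy: "dist x' y \<le> r'" by (rule dist_le_of_mem_kball)
  have "x \<in> kball k x ((1 + sqrt 2) * r)"
    using r sqrt2 by (intro center_mem_kball mult_pos_pos) linarith+
  then have dx: "dist x' x \<le> r'"
    unfolding eq by (rule dist_le_of_mem_kball)
  show ?thesis
  proof (cases "s \<le> sqrt 2 * r'")
    case True
    with dy show ?thesis by (intro kball_subset_kball) (simp add: algebra_simps)
  next
    case False
    have "dist x y \<le> 2 * r'"
      using dx dy dist_triangle[of x y x'] by (simp add: dist_commute)
    \<comment> \<open>This fixes the dilation factor: for a general t > 1, failure of the first case
      gives r' < s / (t - 1), and 2 r' \<le> (t - 1) r then follows from s \<le> r as soon as (t -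
      1)^2 \<ge> 2.\<close>
    also have "\<dots> = sqrt 2 * (sqrt 2 * r')" by simp
    also have "\<dots> \<le> sqrt 2 * r" using False sr by (intro mult_left_mono) auto
    finally have "kball k y s \<subseteq> kball k x ((1 + sqrt 2) * r)"
      using sr by (intro kball_subset_kball) (simp add: algebra_simps)
    also have "\<dots> \<subseteq> kball k x' ((1 + sqrt 2) * r')"
      unfolding eq using r' by (intro kball_subset_kball) (simp add: algebra_simps)
    finally show ?thesis .
  qed
qed

text \<open>Each use of bounded growth, one in \<open>growth\<close> and one from
  \<open>bling\<close>, contributes a factor C. The recentered dilation stays behind
  \<open>E\<close> because the covering argument needs only its measure and the engulfing
  property.\<close>

lemma weakly_bling_engulfing:
  fixes M :: "'a::metric_space measure"
  assumes bling: "weakly_bling k (1 + sqrt 2) C M" and C: "C \<ge> 0" and r: "r > 0"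
    and growth: "emeasure M (kball k x ((1 + sqrt 2) * r)) \<le> ennreal C * emeasure M (kball k x r)"
  shows "\<exists>E\<in>sets borel. emeasure M E \<le> ennreal (C\<^sup>2) * emeasure M (kball k x r) \<and>
    (\<forall>y s. s \<le> r \<longrightarrow> kball k x r \<inter> kball k y s \<noteq> {} \<longrightarrow> kball k y s \<subseteq> E)"
proof -
  have "(1 + sqrt 2) * r > 0" using r by (intro mult_pos_pos) (auto intro: add_pos_pos)
  then have "kball k x ((1 + sqrt 2) * r) \<in> balls k" by (rule kball_in_balls)
  then obtain x' r' where r': "r' > 0" and eq: "kball k x ((1 + sqrt 2) * r) = kball k x' r'"
    and le: "emeasure M (kball k x' ((1 + sqrt 2) * r')) \<le> ennreal C * emeasure M (kball k x' r')"
    using bling unfolding weakly_bling_def by blast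
  note le
  also have "ennreal C * emeasure M (kball k x' r')
      \<le> ennreal C * (ennreal C * emeasure M (kball k x r))"
    using growth unfolding eq by (rule mult_left_mono) simp
  also have "\<dots> = ennreal (C\<^sup>2) * emeasure M (kball k x r)"
    using C by (simp add: power2_eq_square ennreal_mult mult.assoc)
  finally show ?thesis
    using kball_subset_of_meets[OF r _ _ eq r'] by (intro bexI[OF _ kball_borel]) blast
qed

section \<open>The Vitali covering argument for finite families\<close>

text \<open>Greedy selection: keep a set \<open>A\<close> of largest rank, drop all sets meeting it,
  since they lie in \<open>E A\<close>, and recurse on the sets disjoint from \<open>A\<close>. The
  rank will be a chosen radius.\<close>

lemma finite_disjoint_engulfing_subfamily:
  fixes rank :: "'a set \<Rightarrow> 'b::linorder"
  assumes "finite \<F>"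
    and "\<And>A B. A \<in> \<F> \<Longrightarrow> B \<in> \<F> \<Longrightarrow> rank B \<le> rank A \<Longrightarrow> A \<inter> B \<noteq> {} \<Longrightarrow> B \<subseteq> E A"
  shows "\<exists>\<G>\<subseteq>\<F>. disjoint \<G> \<and> \<Union>\<F> \<subseteq> (\<Union>A\<in>\<G>. E A)"
  using assms
proof (induction \<F> rule: finite_psubset_induct)
  case (psubset \<F>)
  show ?case
  proof (cases "\<F> = {}")
    case True
    then show ?thesis by (intro exI[of _ "{}"]) auto
  next
    case False
    have "Max (rank ` \<F>) \<in> rank ` \<F>" using False psubset.hyps by simp
    then obtain A where A: "A \<in> \<F>" "rank A = Max (rank ` \<F>)" by auto
    then have max: "rank B \<le> rank A" if "B \<in> \<F>" for B
      using that psubset.hyps by simp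
    \<comment> \<open>The condition \<open>B \<noteq> A\<close> makes the subfamily strictly smaller
      even when \<open>A\<close> is empty and hence disjoint from itself.\<close>
    define \<F>' where "\<F>' = {B \<in> \<F>. B \<noteq> A \<and> A \<inter> B = {}}"
    have "\<exists>\<G>\<subseteq>\<F>'. disjoint \<G> \<and> \<Union>\<F>' \<subseteq> (\<Union>A\<in>\<G>. E A)"
    proof (rule psubset.IH)
      show "\<F>' \<subset> \<F>" using A by (auto simp: \<F>'_def)
      show "B' \<subseteq> E B"
        if "B \<in> \<F>'" "B' \<in> \<F>'" "rank B' \<le> rank B" "B \<inter> B' \<noteq> {}" for B B'
        using that(1,2) by (intro psubset.prems that(3,4)) (simp_all add: \<F>'_def)
    qed
    then obtain \<G> where \<G>: "\<G> \<subseteq> \<F>'" "disjoint \<G>" "\<Union>\<F>' \<subseteq> (\<Union>A\<in>\<G>. E A)"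
      by (elim exE conjE) (rule that)
    have "B \<subseteq> (\<Union>A\<in>insert A \<G>. E A)" if "B \<in> \<F>" for B
    proof (cases "B \<in> \<F>'")
      case True
      then show ?thesis using \<G>(3) by blast
    next
      case False
      \<comment> \<open>The case \<open>B = A\<close> is included: \<open>A\<close> is empty or
        meets itself.\<close>
      then have "B = {} \<or> A \<inter> B \<noteq> {}" using that by (auto simp: \<F>'_def)
      then show ?thesis using psubset.prems[OF A(1) that max[OF that]] by blast
    qed
    moreover have "disjoint (insert A \<G>)"
      using \<G>(1,2) by (auto simp: disjoint_def \<F>'_def)
    moreover have "insert A \<G> \<subseteq> \<F>" using A(1) \<G>(1) by (auto simp: \<F>'_def)
    ultimately show ?thesis by (intro exI[of _ "insert A \<G>"]) blast
  qed
qed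

text \<open>With respect to \<open>density M f\<close> the left side is the measure of a disjoint
  union.\<close>

lemma sum_set_nn_integral_le:
  assumes f: "f \<in> borel_measurable M" and "finite \<G>" and "disjoint \<G>" and "\<G> \<subseteq> sets M"
  shows "(\<Sum>A\<in>\<G>. \<integral>\<^sup>+y\<in>A. f y \<partial>M) \<le> (\<integral>\<^sup>+y. f y \<partial>M)"
proof -
  have "(\<Sum>A\<in>\<G>. \<integral>\<^sup>+y\<in>A. f y \<partial>M) = (\<Sum>A\<in>\<G>. emeasure (density M f) A)"
    using assms(4) by (intro sum.cong refl) (auto simp: emeasure_density[OF f])
  also have "\<dots> = emeasure (density M f) (\<Union>\<G>)"
    using sum_emeasure[of "\<lambda>A. A" \<G> "density M f"] assms(2-4)
    by (simp add: disjoint_family_on_def disjoint_def)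
  also have "\<dots> \<le> emeasure (density M f) (space M)"
    using emeasure_space[of "density M f"] by simp
  also have "\<dots> = (\<integral>\<^sup>+y. f y \<partial>M)"
    by (simp add: emeasure_density[OF f] cong: nn_integral_cong)
  finally show ?thesis .
qed

text \<open>The union is covered by the sets \<open>E A\<close> of a disjoint subfamily; each costs
  at most C^2 times the measure of \<open>A\<close>, which \<open>avg\<close> bounds by an integral
  over \<open>A\<close>, and disjointness adds these integrals up. Keeping \<open>a\<close> as a
  divisor avoids separate cases for \<open>a\<close> zero or infinite.\<close>

lemma weakly_bling_finite_union_le:
  fixes M :: "'a::metric_space measure"
  assumes sM: "sets M = sets borel"
    and bling: "weakly_bling k (1 + sqrt 2) C M" and C: "C \<ge> 0"
    and f: "f \<in> borel_measurable M"
    and \<F>: "finite \<F>" "\<F> \<subseteq> balls k"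
    and avg: "\<And>B. B \<in> \<F> \<Longrightarrow> emeasure M B \<le> (\<integral>\<^sup>+y\<in>B. f y \<partial>M) / a"
  shows "emeasure M (\<Union>\<F>) \<le> ennreal (C\<^sup>2) * (\<integral>\<^sup>+y. f y \<partial>M) / a"
proof -
  have "\<forall>B\<in>balls k. \<exists>x r. r > 0 \<and> B = kball k x r \<and>
      emeasure M (kball k x ((1 + sqrt 2) * r)) \<le> ennreal C * emeasure M (kball k x r)"
    using bling unfolding weakly_bling_def by blast
  \<comment> \<open>A ball as a set need not determine its center and radius, so one pair with the
    growth bound is fixed for each ball; \<open>\<rho>\<close> is the rank in the greedy
    selection.\<close>
  then obtain c \<rho> where \<rho>: "\<And>B. B \<in> balls k \<Longrightarrow> \<rho> B > 0"
    and B_eq: "\<And>B. B \<in> balls k \<Longrightarrow> B = kball k (c B) (\<rho> B)"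
    and growth: "\<And>B. B \<in> balls k \<Longrightarrow> emeasure M (kball k (c B) ((1 + sqrt 2) * \<rho> B))
      \<le> ennreal C * emeasure M (kball k (c B) (\<rho> B))"
    by metis
  have "\<forall>B\<in>balls k. \<exists>E. E \<in> sets M \<and> emeasure M E \<le> ennreal (C\<^sup>2) * emeasure M B \<and>
      (\<forall>y s. s \<le> \<rho> B \<longrightarrow> B \<inter> kball k y s \<noteq> {} \<longrightarrow> kball k y s \<subseteq> E)"
    using weakly_bling_engulfing[OF bling C \<rho> growth] B_eq unfolding sM by metis
  from bchoice[OF this] obtain E where E: "\<forall>B\<in>balls k. E B \<in> sets M \<and>
      emeasure M (E B) \<le> ennreal (C\<^sup>2) * emeasure M B \<and>
      (\<forall>y s. s \<le> \<rho> B \<longrightarrow> B \<inter> kball k y s \<noteq> {} \<longrightarrow> kball k y s \<subseteq> E B)"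
    by (rule exE)
  have E_meas: "E B \<in> sets M" and E_le: "emeasure M (E B) \<le> ennreal (C\<^sup>2) * emeasure M B"
    if "B \<in> balls k" for B
    using bspec[OF E that] by simp_all
  have engulf: "B \<subseteq> E A" if "A \<in> \<F>" "B \<in> \<F>" "\<rho> B \<le> \<rho> A" "A \<inter> B \<noteq> {}" for A B
  proof -
    have AB: "A \<in> balls k" "B \<in> balls k" using that \<F>(2) by auto
    show ?thesis
      using bspec[OF E AB(1)] that(3,4) B_eq[OF AB(2)] by metis
  qed
  have "\<exists>\<G>\<subseteq>\<F>. disjoint \<G> \<and> \<Union>\<F> \<subseteq> (\<Union>A\<in>\<G>. E A)"
    using \<F>(1) engulf by (rule finite_disjoint_engulfing_subfamily)
  then obtain \<G> where \<G>: "\<G> \<subseteq> \<F>" "disjoint \<G>" "\<Union>\<F> \<subseteq> (\<Union>A\<in>\<G>. E A)"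
    by (elim exE conjE) (rule that)
  have fin: "finite \<G>" using \<G>(1) \<F>(1) by (rule finite_subset)
  have balls: "\<G> \<subseteq> balls k" using \<G>(1) \<F>(2) by blast
  have "emeasure M (\<Union>\<F>) \<le> emeasure M (\<Union>A\<in>\<G>. E A)"
    using \<G>(3) fin balls E_meas by (intro emeasure_mono sets.finite_UN) auto
  also have "\<dots> \<le> (\<Sum>A\<in>\<G>. emeasure M (E A))"
    using fin balls E_meas by (intro emeasure_subadditive_finite) auto
  also have "\<dots> \<le> (\<Sum>A\<in>\<G>. ennreal (C\<^sup>2) * ((\<integral>\<^sup>+y\<in>A. f y \<partial>M) / a))"
    using balls \<G>(1) avg
    by (intro sum_mono order_trans[OF E_le] mult_left_mono) auto
  also have "\<dots> = ennreal (C\<^sup>2) * (\<Sum>A\<in>\<G>. \<integral>\<^sup>+y\<in>A. f y \<partial>M) / a"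
    by (simp add: sum_distrib_left sum_distrib_right divide_ennreal_def mult.assoc)
  also have "\<dots> \<le> ennreal (C\<^sup>2) * (\<integral>\<^sup>+y. f y \<partial>M) / a"
    using balls sM kball_borel
    by (intro divide_right_mono_ennreal mult_left_mono sum_set_nn_integral_le f fin \<G>(2))
      (auto simp: balls_def)
  finally show ?thesis .
qed

section \<open>From superlevel sets to finite families of balls\<close>

text \<open>This turns a large average over a ball into a strict upper bound on its measure.
  Strictness leaves room to enlarge the ball.\<close>

lemma less_divide_swap_ennreal:
  fixes a b c :: ennreal
  assumes "a < b / c" and "0 < c" and "c < top"
  shows "c < b / a"
proof -
  have "a < top" using assms(1) by (rule order.strict_trans2) simp
  have "a * c < b"
  proof (rule ccontr)
    assume "\<not> a * c < b"
    then have "b / c \<le> a"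
      using assms(2) by (intro divide_le_posI_ennreal) (auto simp: mult.commute)
    with assms(1) show False by simp
  qed
  show ?thesis
  proof (rule ccontr)
    assume "\<not> c < b / a"
    then have le: "b / a \<le> c" by simp
    have "a \<noteq> 0"
    proof
      assume "a = 0"
      \<comment> \<open>Division of a positive number by zero gives \<open>top\<close>, which the
        finite \<open>c\<close> cannot bound.\<close>
      with le \<open>a * c < b\<close> assms(3) show False by (auto simp: ennreal_divide_zero split: if_splits)
    qed
    have "b = b / a * a" using \<open>a \<noteq> 0\<close> \<open>a < top\<close>
      by (simp add: ennreal_divide_times)
    also have "\<dots> \<le> c * a" using le by (rule mult_right_mono) simp
    finally show False using \<open>a * c < b\<close> by (simp add: mult.commute)
  qed
qed

text \<open>Tau-additivity speaks about open sets only, so closed balls have to be enlarged slightly.\<close>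

lemma exists_ball_subset_kball_emeasure_less:
  fixes M :: "'a::metric_space measure"
  assumes M: "metric_measure_space M" and r: "r > 0" and x: "x \<in> kball k y r"
    and less: "emeasure M (kball k y r) < b"
  shows "\<exists>s\<ge>r. x \<in> ball y s \<and> ball y s \<subseteq> kball k y s \<and> emeasure M (kball k y s) < b"
proof (cases k)
  case Open
  then show ?thesis using x less by (intro exI[of _ r]) simp
next
  case Closed
  have sM: "sets M = sets borel" and fin: "\<And>s. emeasure M (cball y s) < \<infinity>"
    using M unfolding metric_measure_space_def locally_finite_measure_def by simp_all
  define D where "D n = cball y (r + inverse (real (Suc n)))" for n
  have "(\<Inter>n. D n) = cball y r"
  proof (intro equalityI subsetI)
    fix z assume z: "z \<in> (\<Inter>n. D n)"
    show "z \<in> cball y r"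
    proof (rule ccontr)
      assume "z \<notin> cball y r"
      then have "0 < dist y z - r" by simp
      then obtain n where "inverse (real (Suc n)) < dist y z - r"
        using reals_Archimedean by blast
      moreover have "z \<in> D n" using z by blast
      ultimately show False by (simp add: D_def)
    qed
  next
    fix z assume "z \<in> cball y r"
    then show "z \<in> (\<Inter>n. D n)" by (auto simp: D_def intro: add_increasing2)
  qed
  \<comment> \<open>Continuity from above applies because local finiteness makes the bounded sets
    \<open>D n\<close> of finite measure.\<close>
  moreover have "(INF n. emeasure M (D n)) = emeasure M (\<Inter>n. D n)"
  proof (rule INF_emeasure_decseq)
    show "range D \<subseteq> sets M"
      by (auto simp: D_def sM)
    show "decseq D"
      unfolding D_def decseq_def by (auto intro!: subset_cball le_imp_inverse_le)
    show "emeasure M (D n) \<noteq> \<infinity>" for n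
      using fin by (simp add: D_def less_top)
  qed
  ultimately have "(INF n. emeasure M (D n)) < b" using less Closed by simp
  then obtain n where n: "emeasure M (D n) < b" by (auto simp: INF_less_iff)
  define s where "s = r + inverse (real (Suc n))"
  have "r < s" unfolding s_def by simp
  moreover have "emeasure M (cball y s) < b" using n by (simp add: D_def s_def)
  ultimately show ?thesis
    using x Closed ball_subset_cball by (intro exI[of _ s]) auto
qed

text \<open>The superlevel set is covered by open balls, and tau-additivity reduces the measure of
  their union to finite subfamilies, on which the covering bound is uniform.\<close>

lemma uncentered_maximal_weak_type:
  fixes M :: "'a::metric_space measure"
  assumes M: "metric_measure_space M" and bling: "weakly_bling k (1 + sqrt 2) C M" and C: "C \<ge> 0"
    and g: "integrable M g"
  shows "emeasure M {x \<in> space M. uncentered_maximal k M g x > a}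
    \<le> ennreal (C\<^sup>2) * (\<integral>\<^sup>+y. ennreal \<bar>g y\<bar> \<partial>M) / a"
proof -
  let ?I = "\<lambda>B. \<integral>\<^sup>+y\<in>B. ennreal \<bar>g y\<bar> \<partial>M"
  have sM: "sets M = sets borel" and tau: "tau_additive M"
    using M by (auto simp: metric_measure_space_def)
  have fin: "emeasure M (kball k y s) < top" for y s
    using M kball_borel unfolding metric_measure_space_def locally_finite_measure_def
    by (cases k) auto
  \<comment> \<open>Pairs are recorded rather than sets, so that each open ball in the cover
    remembers the ball of kind \<open>k\<close> with the same center and radius, to which bounded
    growth applies.\<close>
  define P where "P = {(y, s). s > 0 \<and> ball y s \<subseteq> kball k y s \<and>
    emeasure M (kball k y s) < ?I (kball k y s) / a}"
  define \<U> where "\<U> = (\<lambda>(y, s). ball y s) ` P"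
  have "{x \<in> space M. uncentered_maximal k M g x > a} \<subseteq> \<Union>\<U>"
  proof
    fix x assume "x \<in> {x \<in> space M. uncentered_maximal k M g x > a}"
    then obtain y r where r: "r > 0" and x: "x \<in> kball k y r"
      and pos: "0 < emeasure M (kball k y r)"
      and gt: "a < ?I (kball k y r) / emeasure M (kball k y r)"
      unfolding uncentered_maximal_def balls_def by (auto simp: less_SUP_iff)
    have "emeasure M (kball k y r) < ?I (kball k y r) / a"
      using less_divide_swap_ennreal[OF gt pos fin] .
    then obtain s where s: "s \<ge> r" "x \<in> ball y s" "ball y s \<subseteq> kball k y s"
      "emeasure M (kball k y s) < ?I (kball k y r) / a"
      using exists_ball_subset_kball_emeasure_less[OF M r x] by blast
    \<comment> \<open>Enlarging the ball can only increase the integral, so the strict bound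
      survives at radius \<open>s\<close>.\<close>
    have "kball k y r \<subseteq> kball k y s" using s(1) by (intro kball_subset_kball) simp
    then have "?I (kball k y r) / a \<le> ?I (kball k y s) / a"
      by (intro divide_right_mono_ennreal nn_integral_mono mult_left_mono)
        (auto simp: indicator_def)
    then have "(y, s) \<in> P" using r s by (auto simp: P_def)
    then show "x \<in> \<Union>\<U>" using s(2) by (force simp: \<U>_def)
  qed
  then have "emeasure M {x \<in> space M. uncentered_maximal k M g x > a} \<le> emeasure M (\<Union>\<U>)"
    by (rule emeasure_mono) (auto simp: sM \<U>_def intro!: borel_open)
  also have "\<dots> = (SUP \<F>\<in>{\<F>. finite \<F> \<and> \<F> \<subseteq> \<U>}. emeasure M (\<Union>\<F>))"
    by (rule tau[unfolded tau_additive_def, rule_format]) (auto simp: \<U>_def)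
  also have "\<dots> \<le> ennreal (C\<^sup>2) * (\<integral>\<^sup>+y. ennreal \<bar>g y\<bar> \<partial>M) / a"
  proof (rule SUP_least)
    fix \<F> assume "\<F> \<in> {\<F>. finite \<F> \<and> \<F> \<subseteq> \<U>}"
    then obtain Q where Q: "Q \<subseteq> P" "finite Q" "\<F> = (\<lambda>(y, s). ball y s) ` Q"
      unfolding \<U>_def by (auto dest: finite_subset_image)
    let ?\<B> = "(\<lambda>(y, s). kball k y s) ` Q"
    have "emeasure M (\<Union>\<F>) \<le> emeasure M (\<Union>?\<B>)"
    proof (rule emeasure_mono)
      show "\<Union>\<F> \<subseteq> \<Union>?\<B>" using Q(1) unfolding Q(3) by (fastforce simp: P_def)
      show "\<Union>?\<B> \<in> sets M" using Q(2) kball_borel unfolding sM by (intro sets.finite_UN) auto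
    qed
    also have "\<dots> \<le> ennreal (C\<^sup>2) * (\<integral>\<^sup>+y. ennreal \<bar>g y\<bar> \<partial>M) / a"
    proof (rule weakly_bling_finite_union_le[OF sM bling C])
      show "(\<lambda>y. ennreal \<bar>g y\<bar>) \<in> borel_measurable M"
        using borel_measurable_integrable[OF g] by measurable
      show "finite ?\<B>" using Q(2) by simp
      show "?\<B> \<subseteq> balls k" using Q(1) by (auto simp: P_def intro: kball_in_balls)
      show "emeasure M B \<le> ?I B / a" if "B \<in> ?\<B>" for B
        using that Q(1) by (auto simp: P_def less_imp_le)
    qed
    finally show "emeasure M (\<Union>\<F>) \<le> ennreal (C\<^sup>2) * (\<integral>\<^sup>+y. ennreal \<bar>g y\<bar> \<partial>M) / a" .
  qed
  finally show ?thesis .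
qed

theorem theorem3p8:
  fixes M :: "'a::metric_space measure" and k :: ball_kind and C :: real
  assumes "metric_measure_space M"
    and "C \<ge> 1"
    and "weakly_bling k (1 + sqrt 2) C M"
  shows "weak_type_norm M (uncentered_maximal k M) \<le> ennreal (C\<^sup>2)"
  unfolding weak_type_norm_def
  using uncentered_maximal_weak_type[OF assms(1,3)] assms(2) by (intro Inf_lower) auto

end
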